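(* Let $\mathbf{K}$ be an oligomorphic Ramsey age of finite relational structures. Then $\mathbf{Ram}\le_T\mathbf{K}$.
   Context: A relational language is a set $L=\{R_i:i\in I\}$ of relational symbols, each $R_i$ with an arity $r_i\in\mathbb{N}$; an $L$-structure (relational structure) is $\mathcal{A}=(A,R_i^A)_{i\in I}$ where $A$ is a set and $R_i^A\subseteq A^{r_i}$. For $B\subseteq A$, the substructure of $\mathcal{A}$ induced by $B$ is $(B,R_i^A\cap B^{r_i})_{i\in I}$. A mapping $f:A\to B$ is an embedding $f:\mathcal{A}\hookrightarrow\mathcal{B}$ of $L$-structures if $(a_1,\dots,a_{r_i})\in R_i^A\iff(f(a_1),\dots,f(a_{r_i}))\in R_i^B$ for all $i\in I$ and $a_1,\dots,a_{r_i}\in A$; $\mathcal{A}\hookrightarrow\mathcal{B}$ also indicates that such an embedding exists. A class of structures is treated as a category whose morphisms are embeddings. A class $\mathbf{K}$ of finite relational structures is an age if it is the class of all finite substructures of some countable relational structure; equivalently, $\mathbf{K}$ is closed under isomorphisms, contains at most countably many pairwise nonisomorphic structures, has the hereditary property (if $\mathcal{A}\in\mathbf{K}$ and $\mathcal{B}\hookrightarrow\mathcal{A}$ then $\mathcal{B}\in\mathbf{K}$), and is directed (any two members of $\mathbf{K}$ embed into a common member of $\mathbf{K}$). For $\mathcal{A},\mathcal{B},\mathcal{C}\in\mathbf{K}$, $\mathcal{C}\longrightarrow(\mathcal{B})^{\mathcal{A}}_k$ means that $\mathcal{A}\hookrightarrow\mathcal{B}\hookrightarrow\mathcal{C}$ and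 for every $k$-coloring $\chi:\hom(\mathcal{A},\mathcal{C})\to k=\{0,\dots,k-1\}$ there is $w\in\hom(\mathcal{B},\mathcal{C})$ with $|\chi(w\circ\hom(\mathcal{A},\mathcal{B}))|=1$, where $\hom$ denotes the set of embeddings. $\mathbf{K}$ has the Ramsey property if for every $k\in\mathbb{N}=\{1,2,\ldots\}$ and all $\mathcal{A},\mathcal{B}\in\mathbf{K}$ with $\mathcal{A}\hookrightarrow\mathcal{B}$ there is $\mathcal{C}\in\mathbf{K}$ with $\mathcal{C}\longrightarrow(\mathcal{B})^{\mathcal{A}}_k$. A Ramsey age is an age with the Ramsey property (every Ramsey age is a Fraïssé age, i.e. an age with the amalgamation property: for all embeddings $f:\mathcal{A}\hookrightarrow\mathcal{B}$, $g:\mathcal{A}\hookrightarrow\mathcal{C}$ in $\mathbf{K}$ there are $\mathcal{D}\in\mathbf{K}$ and embeddings $f':\mathcal{B}\hookrightarrow\mathcal{D}$, $g':\mathcal{C}\hookrightarrow\mathcal{D}$ with $f'\circ f=g'\circ g$). An age $\mathbf{K}$ is oligomorphic if for each $n\in\mathbb{N}$ there are, up to isomorphism, only finitely many structures of size $n$ in $\mathbf{K}$. $\mathbf{Ram}$ is the category whose objects are finite chains (linearly ordered sets) and whose morphisms are injective monotone maps between them. Pre-adjunction: for locally small categories $\mathbf{B}$ and $\mathbf{C}$ (categories in which all hom-classes are sets), a pair of maps $F:\mathrm{Ob}(\mathbf{B})\to\mathrm{Ob}(\mathbf{C})$, $H:\mathrm{Ob}(\mathbf{C})\to\mathrm{Ob}(\mathbf{B})$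 (not required to be functorial) is a pre-adjunction from $\mathbf{B}$ to $\mathbf{C}$ if there is a family of maps $\Phi_{X,Y}:\hom_{\mathbf{C}}(F(X),Y)\to\hom_{\mathbf{B}}(X,H(Y))$ indexed by pairs $(X,Y)\in\mathrm{Ob}(\mathbf{B})\times\mathrm{Ob}(\mathbf{C})$ such that: (PA) for every $C\in\mathrm{Ob}(\mathbf{C})$, all $A,B\in\mathrm{Ob}(\mathbf{B})$, every $u\in\hom_{\mathbf{C}}(F(B),C)$ and every $f\in\hom_{\mathbf{B}}(A,B)$ there is a $v\in\hom_{\mathbf{C}}(F(A),F(B))$ with $\Phi_{B,C}(u)\cdot f=\Phi_{A,C}(u\cdot v)$. Here $f\cdot g$ means first $g$, then $f$. $\mathbf{B}\le_T\mathbf{C}$ means there is a pre-adjunction from $\mathbf{B}$ to $\mathbf{C}$.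
   Formalization: "Countable" in the definition of age is read as countably infinite (the claim fails for every age of a finite structure, e.g. a single point), and embeddings are taken to be injective. *)

theory Defs
  imports Complex_Main "HOL-Library.FuncSet" "HOL-Library.Infinite_Typeclass"
    "HOL-Library.Countable_Set"
begin

text \<open>
  Tuples are lists. The underlying sets live in one infinite type, so a class of finite structures
  that is closed under isomorphism is a set of structures over that type: every finite structure
  has an isomorphic copy there.
\<close>

record 'i language =
  symbols :: "'i set"
  arity :: "'i \<Rightarrow> nat"

definition relational_language :: "'i language \<Rightarrow> bool" where
  "relational_language L \<longleftrightarrow> (\<forall>i\<in>symbols L. 1 \<le> arity L i)"

record ('i, 'a) rel_structure =
  carrier :: "'a set"
  rel :: "'i \<Rightarrow> 'a list set"

definition tuples :: "'a set \<Rightarrow> nat \<Rightarrow> 'a list set" where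
  "tuples A n = {xs. length xs = n \<and> set xs \<subseteq> A}"

text \<open>
  Indices that are not symbols of the language are interpreted by the empty set, so that two
  structures are equal in HOL exactly if they have the same carrier and the same relations.
\<close>

definition is_structure :: "'i language \<Rightarrow> ('i, 'a) rel_structure \<Rightarrow> bool" where
  "is_structure L A \<longleftrightarrow>
     (\<forall>i\<in>symbols L. rel A i \<subseteq> tuples (carrier A) (arity L i)) \<and>
     (\<forall>i. i \<notin> symbols L \<longrightarrow> rel A i = {})"

definition induced ::
  "'i language \<Rightarrow> ('i, 'a) rel_structure \<Rightarrow> 'a set \<Rightarrow> ('i, 'a) rel_structure" where
  "induced L A B =
     \<lparr>carrier = B,
      rel = (\<lambda>i. if i \<in> symbols L then rel A i \<inter> tuples B (arity L i) else {})\<rparr>"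

text \<open>
  The usual notion of embedding of model theory: injective, and preserving and reflecting all
  relations. Maps are extensional, so that equality of maps from \<open>A\<close> is HOL equality.
\<close>

definition emb ::
  "'i language \<Rightarrow> ('i, 'a) rel_structure \<Rightarrow> ('i, 'b) rel_structure \<Rightarrow> ('a \<Rightarrow> 'b) set" where
  "emb L A B =
     {f \<in> carrier A \<rightarrow>\<^sub>E carrier B. inj_on f (carrier A) \<and>
        (\<forall>i\<in>symbols L. \<forall>xs\<in>tuples (carrier A) (arity L i).
           xs \<in> rel A i \<longleftrightarrow> map f xs \<in> rel B i)}"

definition isomorphic ::
  "'i language \<Rightarrow> ('i, 'a) rel_structure \<Rightarrow> ('i, 'b) rel_structure \<Rightarrow> bool" where
  "isomorphic L A B \<longleftrightarrow> (\<exists>f\<in>emb L A B. f ` carrier A = carrier B)"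

text \<open>
  Here countable means countably infinite, as usual in Fraisse theory. Ages of finite structures
  have to be excluded: the age of a structure with one point and no relations is oligomorphic and
  has the Ramsey property, but there is no pre-adjunction from the category of finite chains to it.
\<close>

definition age :: "'i language \<Rightarrow> ('i, 'a::infinite) rel_structure set \<Rightarrow> bool" where
  "age L K \<longleftrightarrow>
     (\<exists>M :: ('i, 'a) rel_structure.
        is_structure L M \<and> countable (carrier M) \<and> infinite (carrier M) \<and>
        K = {A. is_structure L A \<and>
                (\<exists>B. finite B \<and> B \<subseteq> carrier M \<and> isomorphic L A (induced L M B))})"

definition ramsey_arrow ::
  "'i language \<Rightarrow> ('i, 'a) rel_structure \<Rightarrow> ('i, 'a) rel_structure \<Rightarrow> ('i, 'a) rel_structure \<Rightarrow>
    nat \<Rightarrow> bool"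
  where
  "ramsey_arrow L C B A k \<longleftrightarrow>
     emb L A B \<noteq> {} \<and> emb L B C \<noteq> {} \<and>
     (\<forall>\<chi> \<in> emb L A C \<rightarrow> {..<k}. \<exists>w\<in>emb L B C.
        card (\<chi> ` (\<lambda>f. compose (carrier A) w f) ` emb L A B) = 1)"

definition ramsey_property :: "'i language \<Rightarrow> ('i, 'a) rel_structure set \<Rightarrow> bool" where
  "ramsey_property L K \<longleftrightarrow>
     (\<forall>k\<ge>1. \<forall>A\<in>K. \<forall>B\<in>K. emb L A B \<noteq> {} \<longrightarrow> (\<exists>C\<in>K. ramsey_arrow L C B A k))"

definition ramsey_age :: "'i language \<Rightarrow> ('i, 'a::infinite) rel_structure set \<Rightarrow> bool" where
  "ramsey_age L K \<longleftrightarrow> age L K \<and> ramsey_property L K"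

definition oligomorphic :: "'i language \<Rightarrow> ('i, 'a) rel_structure set \<Rightarrow> bool" where
  "oligomorphic L K \<longleftrightarrow>
     (\<forall>n\<ge>1. \<exists>S. finite S \<and> S \<subseteq> K \<and>
        (\<forall>A\<in>K. card (carrier A) = n \<longrightarrow> (\<exists>B\<in>S. isomorphic L A B)))"

text \<open>\<open>composite \<C> X Y Z g f\<close> is the composite of \<open>f : X \<rightarrow> Y\<close> followed by \<open>g : Y \<rightarrow> Z\<close>.\<close>

record ('o, 'm) cat =
  obj :: "'o set"
  hom :: "'o \<Rightarrow> 'o \<Rightarrow> 'm set"
  ident :: "'o \<Rightarrow> 'm"
  composite :: "'o \<Rightarrow> 'o \<Rightarrow> 'o \<Rightarrow> 'm \<Rightarrow> 'm \<Rightarrow> 'm"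

locale category =
  fixes \<C> :: "('o, 'm) cat"
  assumes ident_hom: "X \<in> obj \<C> \<Longrightarrow> ident \<C> X \<in> hom \<C> X X"
    and comp_hom: "\<lbrakk>X \<in> obj \<C>; Y \<in> obj \<C>; Z \<in> obj \<C>; f \<in> hom \<C> X Y; g \<in> hom \<C> Y Z\<rbrakk>
      \<Longrightarrow> composite \<C> X Y Z g f \<in> hom \<C> X Z"
    and comp_ident_left: "\<lbrakk>X \<in> obj \<C>; Y \<in> obj \<C>; f \<in> hom \<C> X Y\<rbrakk>
      \<Longrightarrow> composite \<C> X Y Y (ident \<C> Y) f = f"
    and comp_ident_right: "\<lbrakk>X \<in> obj \<C>; Y \<in> obj \<C>; f \<in> hom \<C> X Y\<rbrakk>
      \<Longrightarrow> composite \<C> X X Y f (ident \<C> X) = f"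
    and comp_assoc: "\<lbrakk>W \<in> obj \<C>; X \<in> obj \<C>; Y \<in> obj \<C>; Z \<in> obj \<C>;
        f \<in> hom \<C> W X; g \<in> hom \<C> X Y; h \<in> hom \<C> Y Z\<rbrakk>
      \<Longrightarrow> composite \<C> W Y Z h (composite \<C> W X Y g f) =
          composite \<C> W X Z (composite \<C> X Y Z h g) f"

locale pre_adjunction = B: category \<B> + C: category \<C>
  for \<B> :: "('o, 'm) cat" and \<C> :: "('p, 'n) cat" +
  fixes F :: "'o \<Rightarrow> 'p" and H :: "'p \<Rightarrow> 'o" and \<Phi> :: "'o \<Rightarrow> 'p \<Rightarrow> 'n \<Rightarrow> 'm"
  assumes F_obj: "F \<in> obj \<B> \<rightarrow> obj \<C>"
    and H_obj: "H \<in> obj \<C> \<rightarrow> obj \<B>"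
    and Phi_hom: "\<lbrakk>X \<in> obj \<B>; Y \<in> obj \<C>\<rbrakk> \<Longrightarrow> \<Phi> X Y \<in> hom \<C> (F X) Y \<rightarrow> hom \<B> X (H Y)"
    and PA: "\<lbrakk>c \<in> obj \<C>; a \<in> obj \<B>; b \<in> obj \<B>; u \<in> hom \<C> (F b) c; f \<in> hom \<B> a b\<rbrakk>
      \<Longrightarrow> \<exists>v\<in>hom \<C> (F a) (F b).
            composite \<B> a b (H c) (\<Phi> b c u) f = \<Phi> a c (composite \<C> (F a) (F b) c u v)"

definition le_T :: "('o, 'm) cat \<Rightarrow> ('p, 'n) cat \<Rightarrow> bool" (infix "\<le>\<^sub>T" 50) where
  "\<B> \<le>\<^sub>T \<C> \<longleftrightarrow> (\<exists>F H \<Phi>. pre_adjunction \<B> \<C> F H \<Phi>)"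

definition struct_cat ::
  "'i language \<Rightarrow> ('i, 'a) rel_structure set \<Rightarrow> (('i, 'a) rel_structure, 'a \<Rightarrow> 'a) cat" where
  "struct_cat L K =
     \<lparr>obj = K, hom = emb L,
      ident = (\<lambda>A. \<lambda>x\<in>carrier A. x),
      composite = (\<lambda>A B C g f. compose (carrier A) g f)\<rparr>"

text \<open>A chain is a pair of an underlying set and a reflexive linear order on it. The type of its
  points is infinite, so that every finite chain has an isomorphic copy.\<close>

definition Ram :: "('c::infinite set \<times> 'c rel, 'c \<Rightarrow> 'c) cat" where
  "Ram =
     \<lparr>obj = {(X, r). finite X \<and> linear_order_on X r},
      hom = (\<lambda>(X, r) (Y, s). {f \<in> X \<rightarrow>\<^sub>E Y. inj_on f X \<and> (\<forall>(x, y)\<in>r. (f x, f y) \<in> s)}),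
      ident = (\<lambda>(X, r). \<lambda>x\<in>X. x),
      composite = (\<lambda>(X, r) _ _ g f. compose X g f)\<rparr>"

lemma emb_ident: "(\<lambda>x\<in>carrier A. x) \<in> emb L A A"
proof -
  have "map (\<lambda>x\<in>carrier A. x) xs = xs" if "set xs \<subseteq> carrier A" for xs
    using that by (induction xs) auto
  then show ?thesis by (auto simp: emb_def tuples_def inj_on_def)
qed

lemma emb_compose:
  assumes f: "f \<in> emb L A B" and g: "g \<in> emb L B C"
  shows "compose (carrier A) g f \<in> emb L A C"
proof -
  have f1: "f \<in> carrier A \<rightarrow>\<^sub>E carrier B" "inj_on f (carrier A)"
    and g1: "g \<in> carrier B \<rightarrow>\<^sub>E carrier C" "inj_on g (carrier B)"
    using f g by (auto simp: emb_def)
  have "compose (carrier A) g f \<in> carrier A \<rightarrow>\<^sub>E carrier C"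
    using f1 g1 by (auto simp: compose_def)
  moreover have "inj_on (compose (carrier A) g f) (carrier A)"
    using f1 g1 by (auto simp: inj_on_def compose_eq Pi_def PiE_def)
  moreover have "xs \<in> rel A i \<longleftrightarrow> map (compose (carrier A) g f) xs \<in> rel C i"
    if i: "i \<in> symbols L" and xs: "xs \<in> tuples (carrier A) (arity L i)" for i xs
  proof -
    have "map (compose (carrier A) g f) xs = map g (map f xs)"
      using xs by (auto simp: tuples_def compose_eq)
    moreover have "map f xs \<in> tuples (carrier B) (arity L i)"
      using xs f1 by (auto simp: tuples_def)
    ultimately show ?thesis
      using f g i xs by (auto simp: emb_def simp del: map_map)
  qed
  ultimately show ?thesis by (auto simp: emb_def)
qed

lemma category_struct_cat: "category (struct_cat L K)"
proof
  fix A B f assume "f \<in> hom (struct_cat L K) A B"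
  then have f: "f \<in> carrier A \<rightarrow>\<^sub>E carrier B" by (simp add: struct_cat_def emb_def)
  show "composite (struct_cat L K) A B B (ident (struct_cat L K) B) f = f"
    and "composite (struct_cat L K) A A B f (ident (struct_cat L K) A) = f"
    using f by (auto simp: struct_cat_def PiE_def intro: Id_compose compose_Id)
next
  fix A B C D f g h
  assume "f \<in> hom (struct_cat L K) A B"
  then have "f \<in> carrier A \<rightarrow> carrier B" by (auto simp: struct_cat_def emb_def)
  then show "composite (struct_cat L K) A C D h (composite (struct_cat L K) A B C g f) =
      composite (struct_cat L K) A B D (composite (struct_cat L K) B C D h g) f"
    by (simp add: struct_cat_def compose_assoc)
qed (auto simp: struct_cat_def emb_ident emb_compose)

lemma category_Ram: "category (Ram :: ('c::infinite set \<times> 'c rel, 'c \<Rightarrow> 'c) cat)"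
proof
  fix X :: "'c set \<times> 'c rel" assume "X \<in> obj Ram"
  then show "ident Ram X \<in> hom Ram X X"
    by (auto simp: Ram_def inj_on_def order_on_defs)
next
  fix X Y Z :: "'c set \<times> 'c rel" and f g
  assume obj: "X \<in> obj Ram" and f: "f \<in> hom Ram X Y" and g: "g \<in> hom Ram Y Z"
  obtain A r B s C t where XYZ: "X = (A, r)" "Y = (B, s)" "Z = (C, t)"
    by (metis prod.exhaust)
  have r: "r \<subseteq> A \<times> A" using obj by (auto simp: Ram_def XYZ order_on_defs)
  have f1: "f ` A \<subseteq> B" "inj_on f A" "\<And>x y. (x, y) \<in> r \<Longrightarrow> (f x, f y) \<in> s"
    using f by (auto simp: Ram_def XYZ)
  have g1: "g ` B \<subseteq> C" "inj_on g B" "\<And>x y. (x, y) \<in> s \<Longrightarrow> (g x, g y) \<in> t"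
    using g by (auto simp: Ram_def XYZ)
  have "inj_on (g \<circ> f) A" using f1(1,2) g1(2) by (meson comp_inj_on inj_on_subset)
  then have "inj_on (compose A g f) A" by (simp add: inj_on_def compose_eq)
  moreover have "compose A g f \<in> A \<rightarrow>\<^sub>E C" using f1(1) g1(1) by (auto simp: compose_def)
  moreover have "(compose A g f x, compose A g f y) \<in> t" if "(x, y) \<in> r" for x y
  proof -
    have "x \<in> A" "y \<in> A" using r that by auto
    then show ?thesis using that f1(3) g1(3) by (simp add: compose_eq)
  qed
  ultimately show "composite Ram X Y Z g f \<in> hom Ram X Z"
    by (auto simp: Ram_def XYZ)
next
  fix X Y :: "'c set \<times> 'c rel" and f assume "f \<in> hom Ram X Y"
  then have f: "f \<in> fst X \<rightarrow>\<^sub>E fst Y" by (auto simp: Ram_def split: prod.splits)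
  show "composite Ram X Y Y (ident Ram Y) f = f" and "composite Ram X X Y f (ident Ram X) = f"
    using f by (auto simp: Ram_def PiE_def split: prod.splits intro: Id_compose compose_Id)
next
  fix W X Y Z :: "'c set \<times> 'c rel" and f g h assume "f \<in> hom Ram W X"
  then have "f \<in> fst W \<rightarrow> fst X" by (auto simp: Ram_def split: prod.splits)
  then show "composite Ram W Y Z h (composite Ram W X Y g f) =
      composite Ram W X Z (composite Ram X Y Z h g) f"
    by (auto simp: Ram_def compose_assoc split: prod.splits)
qed

end

theory Submission
  imports Defs "HOL-Library.Ramsey"
begin

text \<open>
  Given a structure \<open>B\<close> in the age, apply the Ramsey property simultaneously to the finitely many
  two-element structures, colouring each pair in an arbitrarily ordered large structure by the
  direction of the order. On a monochromatic copy of \<open>B\<close> the order of a pair depends only on its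
  isomorphism type. As there are finitely many such choices, directedness yields one that works for
  all \<open>B\<close>, i.e. a linear order on every structure that is preserved by all embeddings. On the other
  hand, the infinite Ramsey theorem, applied in the countable structure to the isomorphism types of
  its \<open>n\<close>-element substructures for \<open>n = 0, 1, \<dots>\<close> in turn, provides structures \<open>F n\<close> of size
  \<open>n\<close> all of whose \<open>m\<close>-element substructures are isomorphic to \<open>F m\<close>. Let \<open>H\<close> forget everything
  but the canonical order, let \<open>F\<close> map a chain of size \<open>n\<close> to \<open>F n\<close>, and let \<open>\<Phi>\<close> read an embedding
  as a monotone map. A subchain of \<open>F n\<close> of size \<open>m\<close> then is the image of an embedding of \<open>F m\<close>,
  which is monotone and hence the given inclusion.
\<close>

section \<open>Finite chains\<close>

text \<open>On a chain the ranks start at 1, since \<open>r\<close> is reflexive and every point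
  counts itself.\<close>

definition rank :: "'b set \<Rightarrow> 'b rel \<Rightarrow> 'b \<Rightarrow> nat" where
  "rank X r x = card {y \<in> X. (y, x) \<in> r}"

lemma rank_mono:
  assumes "finite X" "linear_order_on X r" "(x, y) \<in> r"
  shows "rank X r x \<le> rank X r y"
  unfolding rank_def
proof (rule card_mono)
  have "trans r" using assms by (simp add: order_on_defs)
  then show "{z \<in> X. (z, x) \<in> r} \<subseteq> {z \<in> X. (z, y) \<in> r}"
    using assms(3) by (auto dest: transD)
qed (use assms in auto)

lemma linear_orderD:
  assumes "linear_order_on X r"
  shows "r \<subseteq> X \<times> X" and "x \<in> X \<Longrightarrow> (x, x) \<in> r"
    and "(x, y) \<in> r \<Longrightarrow> (y, x) \<in> r \<Longrightarrow> x = y"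
    and "(x, y) \<in> r \<Longrightarrow> (y, z) \<in> r \<Longrightarrow> (x, z) \<in> r"
    and "x \<in> X \<Longrightarrow> y \<in> X \<Longrightarrow> (x, y) \<in> r \<or> (y, x) \<in> r"
proof -
  have *: "refl_on X r" "r \<subseteq> X \<times> X" "trans r" "antisym r" "total_on X r"
    using assms by (auto simp: order_on_defs)
  show "r \<subseteq> X \<times> X" by (rule *)
  show "x \<in> X \<Longrightarrow> (x, x) \<in> r" using *(1) by (rule refl_onD)
  show "(x, y) \<in> r \<Longrightarrow> (y, x) \<in> r \<Longrightarrow> x = y" using *(4) by (rule antisymD)
  show "(x, y) \<in> r \<Longrightarrow> (y, z) \<in> r \<Longrightarrow> (x, z) \<in> r" using *(3) by (rule transD)
  show "x \<in> X \<Longrightarrow> y \<in> X \<Longrightarrow> (x, y) \<in> r \<or> (y, x) \<in> r"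
    using *(1,5) by (cases "x = y") (auto simp: total_on_def dest: refl_onD)
qed

text \<open>The sets of points below \<open>x\<close> and below \<open>y\<close> are nested. If they
  have the same finite size they coincide, so \<open>x\<close> and \<open>y\<close> lie below each
  other and antisymmetry applies.\<close>

lemma inj_on_rank:
  assumes X: "finite X" "linear_order_on X r"
  shows "inj_on (rank X r) X"
proof -
  have *: "x = y" if "x \<in> X" "y \<in> X" "(x, y) \<in> r" "rank X r x = rank X r y" for x y
  proof -
    have "{z \<in> X. (z, x) \<in> r} \<subseteq> {z \<in> X. (z, y) \<in> r}"
      using linear_orderD(4)[OF X(2)] that by blast
    then have "{z \<in> X. (z, x) \<in> r} = {z \<in> X. (z, y) \<in> r}"
      using that X by (intro card_subset_eq) (auto simp: rank_def)
    moreover have "y \<in> {z \<in> X. (z, y) \<in> r}" using linear_orderD(2)[OF X(2)] that by blast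
    ultimately have "(y, x) \<in> r" by blast
    then show ?thesis using linear_orderD(3)[OF X(2)] that by blast
  qed
  show ?thesis
  proof (rule inj_onI)
    fix x y assume "x \<in> X" "y \<in> X" "rank X r x = rank X r y"
    then show "x = y" using *[of x y] *[of y x] linear_orderD(5)[OF X(2), of x y] by auto
  qed
qed

lemma rank_image:
  assumes X: "finite X" "linear_order_on X r"
  shows "rank X r ` X = {1..card X}"
proof (rule card_subset_eq)
  show "rank X r ` X \<subseteq> {1..card X}"
  proof clarify
    fix x assume x: "x \<in> X"
    then have "{y \<in> X. (y, x) \<in> r} \<noteq> {}" using linear_orderD(2)[OF X(2)] by blast
    then have "rank X r x > 0" using X by (simp add: rank_def card_gt_0_iff)
    moreover have "rank X r x \<le> card X" unfolding rank_def using X by (intro card_mono) auto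
    ultimately show "rank X r x \<in> {1..card X}" by auto
  qed
qed (auto simp: card_image inj_on_rank X)

text \<open>Points of equal rank are matched with each other.\<close>

lemma finite_chains_isomorphic:
  assumes X: "finite X" "linear_order_on X r" and Y: "finite Y" "linear_order_on Y s"
    and card: "card X = card Y"
  shows "\<exists>e. bij_betw e X Y \<and> (\<forall>(x, y)\<in>r. (e x, e y) \<in> s)"
proof (intro exI conjI ballI)
  let ?e = "inv_into Y (rank Y s) \<circ> rank X r"
  have bX: "bij_betw (rank X r) X {1..card Y}"
    using X card by (simp add: bij_betw_def inj_on_rank rank_image)
  have bY: "bij_betw (rank Y s) Y {1..card Y}"
    using Y by (simp add: bij_betw_def inj_on_rank rank_image)
  show e: "bij_betw ?e X Y" using bX bY by (meson bij_betw_inv_into bij_betw_trans)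
  have rk: "rank Y s (?e x) = rank X r x" if "x \<in> X" for x
    using that bX bY by (metis bij_betw_imp_surj_on comp_apply f_inv_into_f imageI)
  fix p assume "p \<in> r"
  then obtain x y where p: "p = (x, y)" "(x, y) \<in> r" by (cases p) auto
  then have xy: "x \<in> X" "y \<in> X" using linear_orderD(1)[OF X(2)] by auto
  then have e': "?e x \<in> Y" "?e y \<in> Y" using e by (auto simp: bij_betw_def)
  have "(?e x, ?e y) \<in> s"
  proof (cases "(?e y, ?e x) \<in> s")
    case True
    \<comment> \<open>Ranks are monotone in both chains, so a pair with reversed images has images
      of equal rank, which are one and the same point.\<close>
    then have "rank Y s (?e y) = rank Y s (?e x)"
      using rank_mono[OF X p(2)] rank_mono[OF Y True] rk xy by auto
    then have "?e x = ?e y" using e' inj_on_rank[OF Y] by (auto dest: inj_onD)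
    then show ?thesis using True by metis
  next
    case False
    then show ?thesis using linear_orderD(5)[OF Y(2) e'] by blast
  qed
  then show "case p of (x, y) \<Rightarrow> (?e x, ?e y) \<in> s" using p by simp
qed

text \<open>A monotone bijection between chains also reflects the order, by totality of
  \<open>r\<close> and antisymmetry of \<open>s\<close>. It therefore preserves ranks, and a point
  of \<open>Y\<close> is determined by its rank.\<close>

lemma monotone_injections_unique:
  assumes X: "linear_order_on X r" and Y: "finite Y" "linear_order_on Y s"
    and f: "inj_on f X" "f ` X = Y" "\<And>x y. (x, y) \<in> r \<Longrightarrow> (f x, f y) \<in> s"
    and g: "inj_on g X" "g ` X = Y" "\<And>x y. (x, y) \<in> r \<Longrightarrow> (g x, g y) \<in> s"
    and x: "x \<in> X"
  shows "f x = g x"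
proof -
  have rk: "rank Y s (h x) = rank X r x"
    if h: "inj_on h X" "h ` X = Y" "\<And>x y. (x, y) \<in> r \<Longrightarrow> (h x, h y) \<in> s" for h
  proof -
    have "(y, x) \<in> r" if "y \<in> X" "(h y, h x) \<in> s" for y
      using that x h linear_orderD[OF X] linear_orderD(3)[OF Y(2)] by (metis inj_onD)
    then have "{z \<in> Y. (z, h x) \<in> s} = h ` {y \<in> X. (y, x) \<in> r}" using h by auto
    moreover have "inj_on h {y \<in> X. (y, x) \<in> r}" using h(1) by (rule inj_on_subset) auto
    ultimately show ?thesis by (simp add: rank_def card_image)
  qed
  have "rank Y s (f x) = rank Y s (g x)" using rk[OF f] rk[OF g] by simp
  moreover have "f x \<in> Y" "g x \<in> Y" using f(2) g(2) x by auto
  ultimately show ?thesis by (rule inj_onD[OF inj_on_rank[OF Y]])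
qed

text \<open>Serves to copy the order of a structure to a chain over another type of points.\<close>

lemma linear_order_on_image:
  assumes X: "linear_order_on X r" and j: "inj_on j X"
  shows "linear_order_on (j ` X) ((\<lambda>(x, y). (j x, j y)) ` r)"
proof -
  note X' = linear_orderD[OF X]
  have eq: "x = y" if "j x = j y" "x \<in> X" "y \<in> X" for x y using that j by (auto dest: inj_onD)
  show ?thesis
    unfolding order_on_defs
  proof (intro conjI)
    show "refl_on (j ` X) ((\<lambda>(x, y). (j x, j y)) ` r)"
      using X'(2) by (force simp: refl_on_def)
    show "(\<lambda>(x, y). (j x, j y)) ` r \<subseteq> j ` X \<times> j ` X"
      using X'(1) by auto
    show "trans ((\<lambda>(x, y). (j x, j y)) ` r)"
    proof (rule transI, clarsimp)
      fix x y y' z assume a: "(x, y) \<in> r" "j y = j y'" "(y', z) \<in> r"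
      then have "y = y'" using eq X'(1) by blast
      then have "(x, z) \<in> r" using a X'(4) by blast
      then show "(j x, j z) \<in> (\<lambda>(x, y). (j x, j y)) ` r" by force
    qed
    show "antisym ((\<lambda>(x, y). (j x, j y)) ` r)"
    proof (rule antisymI, clarsimp)
      fix x y x' y' assume a: "(x, y) \<in> r" "(y', x') \<in> r" "j x = j x'" "j y = j y'"
      then have "x = x'" "y = y'" using eq X'(1) by blast+
      then show "j x' = j y'" using a X'(3) by blast
    qed
    show "total_on (j ` X) ((\<lambda>(x, y). (j x, j y)) ` r)"
      using X'(5) by (force simp: total_on_def)
  qed
qed

lemma linear_order_on_restrict:
  assumes "linear_order_on X r" "Y \<subseteq> X"
  shows "linear_order_on Y (r \<inter> Y \<times> Y)"
  using assms unfolding order_on_defs refl_on_def total_on_def antisym_def trans_def by blast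

section \<open>Embeddings and ages\<close>

lemma is_structure_induced: "is_structure L (induced L M B)"
  by (auto simp: is_structure_def induced_def)

lemma emb_inclusion:
  assumes "B \<subseteq> carrier M"
  shows "(\<lambda>x\<in>B. x) \<in> emb L (induced L M B) M"
proof -
  have "map (\<lambda>x\<in>B. x) xs = xs" if "set xs \<subseteq> B" for xs
    using that by (induction xs) auto
  then show ?thesis using assms by (auto simp: emb_def tuples_def induced_def inj_on_def)
qed

lemma emb_induced_image:
  assumes f: "f \<in> emb L A M" and B: "f ` carrier A \<subseteq> B"
  shows "f \<in> emb L A (induced L M B)"
proof -
  have "map f xs \<in> tuples B n" if "xs \<in> tuples (carrier A) n" for xs n
    using that B by (auto simp: tuples_def)
  then show ?thesis using f B by (auto simp: emb_def induced_def)
qed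

lemma emb_induced_subset:
  assumes "B \<subseteq> B'"
  shows "(\<lambda>x\<in>B. x) \<in> emb L (induced L M B) (induced L M B')"
proof -
  have "map (\<lambda>x\<in>B. x) xs = xs" if "set xs \<subseteq> B" for xs
    using that by (induction xs) auto
  then show ?thesis using assms by (auto simp: emb_def tuples_def induced_def inj_on_def)
qed

lemma emb_inverse:
  assumes f: "f \<in> emb L A B" and surj: "f ` carrier A = carrier B"
  shows "(\<lambda>y\<in>carrier B. inv_into (carrier A) f y) \<in> emb L B A" (is "?g \<in> _")
proof -
  have inj: "inj_on f (carrier A)" using f by (simp add: emb_def)
  have g: "?g ` carrier B = carrier A" "inj_on ?g (carrier B)"
    using inv_into_image_cancel[OF inj subset_refl] inj_on_inv_into[of "carrier B" f] surj
    by (simp_all add: inj_on_restrict_eq)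
  have "xs \<in> rel B i \<longleftrightarrow> map ?g xs \<in> rel A i"
    if i: "i \<in> symbols L" and xs: "xs \<in> tuples (carrier B) (arity L i)" for i xs
  proof -
    have "map f (map ?g xs) = xs"
      using xs surj by (auto simp: tuples_def f_inv_into_f intro!: map_idI)
    moreover have "map ?g xs \<in> tuples (carrier A) (arity L i)"
      using xs g by (auto simp: tuples_def)
    ultimately show ?thesis using f i by (auto simp: emb_def simp del: map_map)
  qed
  moreover have "?g \<in> carrier B \<rightarrow>\<^sub>E carrier A" using g by auto
  ultimately show ?thesis using g by (auto simp: emb_def)
qed

lemma isomorphic_sym:
  assumes "isomorphic L A B" shows "isomorphic L B A"
proof -
  obtain f where f: "f \<in> emb L A B" "f ` carrier A = carrier B"
    using assms by (auto simp: isomorphic_def)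
  have "(\<lambda>y\<in>carrier B. inv_into (carrier A) f y) ` carrier B = carrier A"
    using f inv_into_image_cancel[of f "carrier A" "carrier A"] by (simp add: emb_def)
  then show ?thesis unfolding isomorphic_def using emb_inverse[OF f] by (rule bexI)
qed

lemma isomorphic_trans:
  assumes "isomorphic L A B" "isomorphic L B C" shows "isomorphic L A C"
proof -
  obtain f g where f: "f \<in> emb L A B" "f ` carrier A = carrier B"
    and g: "g \<in> emb L B C" "g ` carrier B = carrier C"
    using assms by (auto simp: isomorphic_def)
  have "compose (carrier A) g f ` carrier A = carrier C"
    using f(2) g(2) by (simp add: compose_def) (metis image_image)
  then show ?thesis using emb_compose[OF f(1) g(1)] by (auto simp: isomorphic_def)
qed

lemma isomorphic_card:
  assumes "isomorphic L A B" shows "card (carrier A) = card (carrier B)"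
  using assms by (auto simp: isomorphic_def emb_def) (metis card_image)

text \<open>Replaces isomorphism with an induced substructure by embeddability into
  \<open>M\<close>: an isomorphism followed by the inclusion is an embedding, and an embedding is an
  isomorphism onto its image.\<close>

lemma age_eq:
  "{A. is_structure L A \<and> (\<exists>B. finite B \<and> B \<subseteq> carrier M \<and> isomorphic L A (induced L M B))} =
    {A. is_structure L A \<and> finite (carrier A) \<and> emb L A M \<noteq> {}}"
proof -
  have "finite (carrier A) \<and> emb L A M \<noteq> {}"
    if "finite B" "B \<subseteq> carrier M" "isomorphic L A (induced L M B)" for A B
  proof -
    obtain f where f: "f \<in> emb L A (induced L M B)"
      using \<open>isomorphic L A (induced L M B)\<close> by (auto simp: isomorphic_def)
    have "finite (carrier A)"
      using f that(1) inj_on_finite[of f "carrier A" B] by (auto simp: emb_def induced_def)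
    then show ?thesis
      using emb_compose[OF f emb_inclusion[OF that(2)]] by blast
  qed
  moreover have "\<exists>B. finite B \<and> B \<subseteq> carrier M \<and> isomorphic L A (induced L M B)"
    if "finite (carrier A)" and f: "f \<in> emb L A M" for A f
  proof (intro exI conjI)
    show "finite (f ` carrier A)" using that by simp
    show "f ` carrier A \<subseteq> carrier M" using f by (auto simp: emb_def)
    show "isomorphic L A (induced L M (f ` carrier A))"
      unfolding isomorphic_def
      by (rule bexI[OF _ emb_induced_image[OF f subset_refl]]) (simp add: induced_def)
  qed
  ultimately show ?thesis by blast
qed

lemma age_alt:
  fixes K :: "('i, 'a::infinite) rel_structure set"
  assumes "age L K"
  obtains M :: "('i, 'a) rel_structure" where "infinite (carrier M)"
    and "\<And>A. A \<in> K \<longleftrightarrow> is_structure L A \<and> finite (carrier A) \<and> emb L A M \<noteq> {}"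
  using assms unfolding age_def age_eq by blast

lemma age_finite: "age L K \<Longrightarrow> A \<in> K \<Longrightarrow> finite (carrier A)"
  by (erule age_alt) auto

lemma age_induced:
  fixes K :: "('i, 'a::infinite) rel_structure set"
  assumes "age L K" "A \<in> K" "B \<subseteq> carrier A"
  shows "induced L A B \<in> K"
proof -
  obtain M :: "('i, 'a) rel_structure"
    where M: "\<And>A. A \<in> K \<longleftrightarrow> is_structure L A \<and> finite (carrier A) \<and> emb L A M \<noteq> {}"
    using age_alt[OF assms(1)] by blast
  then obtain f where "f \<in> emb L A M" using assms by blast
  then have "emb L (induced L A B) M \<noteq> {}"
    using emb_compose[OF emb_inclusion[OF assms(3)]] by blast
  moreover have "finite (carrier (induced L A B))"
    using M assms(2,3) finite_subset by (auto simp: induced_def)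
  ultimately show ?thesis using M is_structure_induced by blast
qed

text \<open>All members of \<open>T\<close> embed into the common structure \<open>M\<close>; the
  union of the finitely many finite images induces a finite substructure of
  \<open>M\<close>.\<close>

lemma age_directed:
  fixes K :: "('i, 'a::infinite) rel_structure set"
  assumes "age L K" "finite T" "T \<subseteq> K"
  shows "\<exists>D\<in>K. \<forall>A\<in>T. emb L A D \<noteq> {}"
proof -
  obtain M :: "('i, 'a) rel_structure"
    where M: "\<And>A. A \<in> K \<longleftrightarrow> is_structure L A \<and> finite (carrier A) \<and> emb L A M \<noteq> {}"
    using age_alt[OF assms(1)] by blast
  then have "\<exists>f. f \<in> emb L A M" if "A \<in> T" for A using that assms(3) by blast
  then obtain f where f: "\<And>A. A \<in> T \<Longrightarrow> f A \<in> emb L A M" by metis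
  define B where "B = (\<Union>A\<in>T. f A ` carrier A)"
  have "B \<subseteq> carrier M" using f by (auto simp: B_def emb_def)
  moreover have "finite B" using assms M by (auto simp: B_def)
  ultimately have "induced L M B \<in> K"
    using M[of "induced L M B"] is_structure_induced[of L M B] emb_inclusion[of B M L]
    by (auto simp: induced_def)
  moreover have "f A \<in> emb L A (induced L M B)" if "A \<in> T" for A
    using that by (intro emb_induced_image[OF f]) (auto simp: B_def)
  ultimately show ?thesis by blast
qed

section \<open>The canonical order of an oligomorphic Ramsey age\<close>

text \<open>Induction on \<open>S\<close>: a Ramsey arrow takes care of the new member
  \<open>A\<close> by passing from \<open>B\<close> to some \<open>B'\<close>, and the induction
  hypothesis for \<open>B'\<close> takes care of the others. Composing the two embeddings keeps the
  second constancy, because embeddings into \<open>B\<close> become embeddings into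
  \<open>B'\<close>.\<close>

lemma ramsey_property_simultaneous:
  assumes K: "ramsey_property L K" and S: "finite S" "S \<subseteq> K" and B: "B \<in> K"
  shows "\<exists>C\<in>K. \<forall>\<chi>. \<exists>w\<in>emb L B C. \<forall>A\<in>S. \<exists>b::bool. \<forall>g\<in>emb L A B.
           \<chi> A (compose (carrier A) w g) = b"
  using S B
proof (induction S arbitrary: B rule: finite_induct)
  case empty
  then show ?case by (intro bexI[of _ B] allI bexI[OF _ emb_ident]) auto
next
  case (insert A S)
  show ?case
  proof (cases "emb L A B = {}")
    \<comment> \<open>The condition on \<open>A\<close> is vacuous here, and no arrow with
      \<open>A\<close> is available.\<close>
    case True
    have "S \<subseteq> K" using insert.prems by simp
    then show ?thesis using insert.IH[OF _ insert.prems(2)] True by simp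
  next
    case False
    have "\<exists>B'\<in>K. ramsey_arrow L B' B A 2"
      using K[unfolded ramsey_property_def, rule_format, of 2 A B] insert.prems False by simp
    then obtain B' where B': "B' \<in> K" "ramsey_arrow L B' B A 2" by blast
    obtain C where C: "C \<in> K" "\<And>\<chi>. \<exists>w\<in>emb L B' C. \<forall>A\<in>S. \<exists>b::bool. \<forall>g\<in>emb L A B'.
           \<chi> A (compose (carrier A) w g) = b"
      using insert.IH[OF _ B'(1)] insert.prems by blast
    have "\<exists>w\<in>emb L B C. \<forall>A'\<in>insert A S. \<exists>b::bool. \<forall>g\<in>emb L A' B.
           \<chi> A' (compose (carrier A') w g) = b" for \<chi> :: "_ \<Rightarrow> _ \<Rightarrow> bool"
    proof -
      obtain w' where w': "w' \<in> emb L B' C" "\<And>A. A \<in> S \<Longrightarrow> \<exists>b::bool. \<forall>g\<in>emb L A B'.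
           \<chi> A (compose (carrier A) w' g) = b"
        using C(2)[of \<chi>] by blast
      \<comment> \<open>The colouring of the copies of \<open>A\<close> in \<open>C\<close>, pulled
        back to \<open>B'\<close> along \<open>w'\<close>; the colour 0 stands for True.\<close>
      define c where "c g = (if \<chi> A (compose (carrier A) w' g) then 0 else 1::nat)" for g
      have "c \<in> emb L A B' \<rightarrow> {..<2}" by (auto simp: c_def)
      then obtain w where w: "w \<in> emb L B B'"
        and mono: "card (c ` (\<lambda>f. compose (carrier A) w f) ` emb L A B) = 1"
        using B'(2) unfolding ramsey_arrow_def by blast
      obtain d where d: "\<And>g. g \<in> emb L A B \<Longrightarrow> c (compose (carrier A) w g) = d"
        using mono by (auto simp: card_1_singleton_iff)
      have assoc: "compose (carrier A') (compose (carrier B) w' w) g =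
          compose (carrier A') w' (compose (carrier A') w g)" if "g \<in> emb L A' B" for A' g
        using that by (intro compose_assoc[symmetric]) (auto simp: emb_def)
      have "\<exists>b::bool. \<forall>g\<in>emb L A' B. \<chi> A' (compose (carrier A') (compose (carrier B) w' w) g) = b"
        if "A' \<in> insert A S" for A'
      proof (cases "A' = A")
        case True
        have "\<chi> A (compose (carrier A) (compose (carrier B) w' w) g) = (d = 0)"
          if "g \<in> emb L A B" for g
          using d[OF that] by (auto simp: assoc[OF that] c_def split: if_splits)
        then show ?thesis using True by blast
      next
        case False
        then have "A' \<in> S" using \<open>A' \<in> insert A S\<close> by simp
        from w'(2)[OF this]
        obtain b where "\<forall>g\<in>emb L A' B'. \<chi> A' (compose (carrier A') w' g) = b" ..
        then have "\<chi> A' (compose (carrier A') (compose (carrier B) w' w) g) = b"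
          if "g \<in> emb L A' B" for g
          using emb_compose[OF that w] by (simp add: assoc[OF that])
        then show ?thesis by blast
      qed
      then show ?thesis using emb_compose[OF w w'(1)] by blast
    qed
    then show ?thesis using C(1) by blast
  qed
qed

text \<open>\<open>p\<close> selects the smaller point of each two-element structure in \<open>S\<close>.\<close>

definition pair_order ::
  "'i language \<Rightarrow> ('i, 'a) rel_structure set \<Rightarrow> (('i, 'a) rel_structure \<Rightarrow> 'a) \<Rightarrow>
    ('i, 'a) rel_structure \<Rightarrow> 'a rel"
  where
  "pair_order L S p C = {(x, y) \<in> carrier C \<times> carrier C.
     x = y \<or> (\<exists>A\<in>S. \<exists>g\<in>emb L A C. x = g (p A) \<and> y \<in> g ` carrier A)}"

text \<open>An embedding \<open>g\<close> that witnesses a pair in \<open>B\<close> becomes a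
  witness in \<open>C\<close> after composition with \<open>f\<close>. So any selection
  \<open>p\<close> gives relations preserved by embeddings, even if they are not yet orders.\<close>

lemma pair_order_emb:
  assumes p: "\<And>A. A \<in> S \<Longrightarrow> p A \<in> carrier A"
    and f: "f \<in> emb L B C" and xy: "(x, y) \<in> pair_order L S p B"
  shows "(f x, f y) \<in> pair_order L S p C"
proof -
  have f': "f x \<in> carrier C" "f y \<in> carrier C" using f xy by (auto simp: emb_def pair_order_def)
  consider "x = y" | A g z where "A \<in> S" "g \<in> emb L A B" "x = g (p A)" "y = g z" "z \<in> carrier A"
    using xy by (auto simp: pair_order_def)
  then show ?thesis
  proof cases
    case 1
    then show ?thesis using f' by (auto simp: pair_order_def)
  next
    case 2
    have "f x = compose (carrier A) f g (p A)" "f y = compose (carrier A) f g z"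
      using 2 p by (auto simp: compose_eq)
    then show ?thesis
      using emb_compose[OF 2(2) f] 2(1,5) f' unfolding pair_order_def by blast
  qed
qed

text \<open>The order is \<open>pair_order L S p\<close> for a suitable \<open>p\<close>. Totality
  holds for every selection \<open>p\<close>; antisymmetry and transitivity come from compatibility
  with a numbering, expressed by \<open>good\<close>.\<close>

theorem oligomorphic_ramsey_age_order:
  fixes K :: "('i, 'a::infinite) rel_structure set"
  assumes age: "age L K" and ramsey: "ramsey_property L K" and oligo: "oligomorphic L K"
  shows "\<exists>ord. (\<forall>C\<in>K. linear_order_on (carrier C) (ord C)) \<and>
    (\<forall>B C. \<forall>f\<in>emb L B C. \<forall>(x, y)\<in>ord B. (f x, f y) \<in> ord C)"
proof -
  obtain S' where S': "finite S'" "S' \<subseteq> K"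
    "\<And>A. A \<in> K \<Longrightarrow> card (carrier A) = 2 \<Longrightarrow> \<exists>B\<in>S'. isomorphic L A B"
    using oligo unfolding oligomorphic_def by (metis one_le_numeral)
  \<comment> \<open>The representatives supplied by \<open>oligomorphic\<close> may include
    structures of other sizes.\<close>
  define S where "S = {A \<in> S'. card (carrier A) = 2}"
  have S: "finite S" "S \<subseteq> K" using S' by (auto simp: S_def)
  have S2: "\<exists>B\<in>S. isomorphic L A B" if A: "A \<in> K" "card (carrier A) = 2" for A
  proof -
    obtain B where "B \<in> S'" "isomorphic L A B" using S'(3)[OF A] by blast
    then show ?thesis using isomorphic_card[of L A B] A by (auto simp: S_def)
  qed
  have "\<exists>a b. carrier A = {a, b} \<and> a \<noteq> b" if "A \<in> S" for A
    using that by (auto simp: S_def card_2_iff)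
  then obtain a b where ab: "\<And>A. A \<in> S \<Longrightarrow> carrier A = {a A, b A} \<and> a A \<noteq> b A" by metis
  \<comment> \<open>All selections of one point from each representative. Finiteness of
    \<open>P\<close> is what allows a uniform choice at the end.\<close>
  define P where "P = Pi\<^sub>E S carrier"
  have finP: "finite P" unfolding P_def using S ab by (intro finite_PiE) auto
  \<comment> \<open>Weaker in form than linearity, this condition passes easily to embedded
    structures: a numbering can be pulled back.\<close>
  define good where "good p B \<longleftrightarrow> (\<exists>h::'a \<Rightarrow> nat. inj_on h (carrier B) \<and>
    (\<forall>(x, y)\<in>pair_order L S p B. h x \<le> h y))" for p B
  \<comment> \<open>Two distinct points induce a structure isomorphic to some \<open>A\<close> in
    \<open>S\<close>; the image of \<open>p A\<close> is one of them and lies below the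
    other.\<close>
  have total: "(x, y) \<in> pair_order L S p B \<or> (y, x) \<in> pair_order L S p B"
    if p: "p \<in> P" and B: "B \<in> K" and xy: "x \<in> carrier B" "y \<in> carrier B" for p B x y
  proof (cases "x = y")
    case True
    then show ?thesis using xy by (simp add: pair_order_def)
  next
    case False
    let ?B = "induced L B {x, y}"
    have sub: "{x, y} \<subseteq> carrier B" using xy by simp
    have "card (carrier ?B) = 2" using False by (simp add: induced_def)
    then obtain A where A: "A \<in> S" "isomorphic L A ?B"
      using S2 age_induced[OF age B sub] isomorphic_sym by blast
    then obtain f where f: "f \<in> emb L A ?B" "f ` carrier A = {x, y}"
      by (auto simp: isomorphic_def induced_def)
    define g where "g = compose (carrier A) (\<lambda>z\<in>{x, y}. z) f"
    have g: "g \<in> emb L A B" unfolding g_def by (rule emb_compose[OF f(1) emb_inclusion[OF sub]])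
    have "g z = f z" if "z \<in> carrier A" for z using that f(2) by (auto simp: g_def compose_eq)
    then have img: "g ` carrier A = {x, y}" using f(2) by force
    moreover have "p A \<in> carrier A" using p A by (auto simp: P_def)
    ultimately have "g (p A) = x \<or> g (p A) = y" by blast
    then show ?thesis
      using A(1) g img xy unfolding pair_order_def by blast
  qed
  \<comment> \<open>A total relation contained in the linear order defined by an injective
    \<open>h\<close> is equal to that order.\<close>
  have linear: "linear_order_on (carrier B) (pair_order L S p B)"
    if p: "p \<in> P" and B: "B \<in> K" and gd: "good p B" for p B
  proof -
    let ?r = "pair_order L S p B"
    obtain h :: "'a \<Rightarrow> nat" where h: "inj_on h (carrier B)" "\<And>x y. (x, y) \<in> ?r \<Longrightarrow> h x \<le> h y"
      using gd by (auto simp: good_def)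
    have sub: "?r \<subseteq> carrier B \<times> carrier B" by (auto simp: pair_order_def)
    have eq: "(x, y) \<in> ?r \<longleftrightarrow> x \<in> carrier B \<and> y \<in> carrier B \<and> h x \<le> h y" for x y
    proof
      assume r: "x \<in> carrier B \<and> y \<in> carrier B \<and> h x \<le> h y"
      show "(x, y) \<in> ?r"
      proof (rule ccontr)
        assume n: "(x, y) \<notin> ?r"
        then have "(y, x) \<in> ?r" using total[OF p B, of x y] r by blast
        moreover from this have "h x = h y" using h(2) r by fastforce
        then have "x = y" using h(1) r by (auto dest: inj_onD)
        ultimately show False using n by simp
      qed
    qed (use h sub in auto)
    show ?thesis
      unfolding order_on_defs
    proof (intro conjI)
      show "antisym ?r" using h(1) by (auto simp: antisym_def eq inj_on_def)
      show "trans ?r" by (rule transI) (auto simp: eq)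
    qed (auto simp: refl_on_def total_on_def eq)
  qed
  have good_emb: "good p B" if "p \<in> P" "emb L B D \<noteq> {}" "good p D" for p B D
  proof -
    obtain f where f: "f \<in> emb L B D" using \<open>emb L B D \<noteq> {}\<close> by blast
    obtain h :: "'a \<Rightarrow> nat" where h: "inj_on h (carrier D)"
      "\<And>x y. (x, y) \<in> pair_order L S p D \<Longrightarrow> h x \<le> h y"
      using \<open>good p D\<close> by (auto simp: good_def)
    have "inj_on (h \<circ> f) (carrier B)"
      using f h(1) by (intro comp_inj_on) (auto simp: emb_def intro: inj_on_subset)
    moreover have "(h \<circ> f) x \<le> (h \<circ> f) y" if "(x, y) \<in> pair_order L S p B" for x y
      using h(2) pair_order_emb[OF _ f that] \<open>p \<in> P\<close> by (auto simp: P_def)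
    ultimately show ?thesis unfolding good_def by blast
  qed
  have good_ex: "\<exists>p\<in>P. good p B" if B: "B \<in> K" for B
  proof -
    obtain C where C: "C \<in> K" "\<And>\<chi>. \<exists>w\<in>emb L B C. \<forall>A\<in>S. \<exists>b::bool. \<forall>g\<in>emb L A B.
           \<chi> A (compose (carrier A) w g) = b"
      using ramsey_property_simultaneous[OF ramsey S B] by blast
    \<comment> \<open>An arbitrary ordering of \<open>C\<close>. A copy of \<open>A\<close> in
      \<open>C\<close> is coloured by whether this ordering puts the image of \<open>a A\<close>
      before that of \<open>b A\<close>.\<close>
    obtain j :: "'a \<Rightarrow> nat" where j: "inj_on j (carrier C)"
      using finite_imp_inj_to_nat_seg[OF age_finite[OF age C(1)]] by blast
    obtain w where w: "w \<in> emb L B C" "\<And>A. A \<in> S \<Longrightarrow> \<exists>c::bool. \<forall>g\<in>emb L A B.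
           (j (compose (carrier A) w g (a A)) \<le> j (compose (carrier A) w g (b A))) = c"
      using C(2)[of "\<lambda>A g. j (g (a A)) \<le> j (g (b A))"] by blast
    \<comment> \<open>The point of \<open>A\<close> that comes first in every copy inside the
      monochromatic \<open>B\<close>. If \<open>A\<close> does not embed into \<open>B\<close>, the
      default is \<open>a A\<close>, which contributes no pair to the relation on
      \<open>B\<close>.\<close>
    define p where "p = (\<lambda>A\<in>S. if \<forall>g\<in>emb L A B. j (w (g (a A))) \<le> j (w (g (b A)))
      then a A else b A)"
    have p: "p \<in> P" using ab by (auto simp: p_def P_def)
    have le: "j (w (g (p A))) \<le> j (w (g z))"
      if A: "A \<in> S" and g: "g \<in> emb L A B" and z: "z \<in> carrier A" for A g z
    proof -
      obtain c where c: "\<And>g. g \<in> emb L A B \<Longrightarrow> (j (w (g (a A))) \<le> j (w (g (b A)))) = c"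
        using w(2)[OF A] ab[OF A] by (auto simp: compose_eq)
      show ?thesis
      proof (cases c)
        case True
        then show ?thesis using c g A z ab[OF A] by (auto simp: p_def)
      next
        case False
        then have "p A = b A" using c g A by (auto simp: p_def)
        moreover have "j (w (g (b A))) \<le> j (w (g (a A)))" using c[OF g] False by linarith
        ultimately show ?thesis using z ab[OF A] by auto
      qed
    qed
    \<comment> \<open>The numbering of \<open>B\<close> inherited from \<open>C\<close> along
      \<open>w\<close> witnesses \<open>good p B\<close>.\<close>
    have "inj_on (j \<circ> w) (carrier B)"
      using w(1) j by (intro comp_inj_on) (auto simp: emb_def intro: inj_on_subset)
    moreover have "(j \<circ> w) x \<le> (j \<circ> w) y" if "(x, y) \<in> pair_order L S p B" for x y
      using that le by (auto simp: pair_order_def)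
    ultimately have "good p B" unfolding good_def by blast
    then show ?thesis using p by blast
  qed
  have "\<exists>p\<in>P. \<forall>B\<in>K. good p B"
  proof (rule ccontr)
    assume "\<not> ?thesis"
    \<comment> \<open>If every selection failed somewhere, one \<open>D\<close> would contain all
      the finitely many failures. A selection good for \<open>D\<close> would then be good for its
      own counterexample.\<close>
    then obtain bad where bad: "\<And>p. p \<in> P \<Longrightarrow> bad p \<in> K \<and> \<not> good p (bad p)" by metis
    obtain D where D: "D \<in> K" "\<And>p. p \<in> P \<Longrightarrow> emb L (bad p) D \<noteq> {}"
      using age_directed[OF age finite_imageI[OF finP, of bad]] bad by fast
    obtain p where "p \<in> P" "good p D" using good_ex[OF D(1)] by blast
    then show False using good_emb D(2) bad by blast
  qed
  then obtain p where p: "p \<in> P" "\<And>B. B \<in> K \<Longrightarrow> good p B" by blast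
  show ?thesis
  proof (intro exI[of _ "pair_order L S p"] conjI ballI allI)
    fix C assume "C \<in> K"
    then show "linear_order_on (carrier C) (pair_order L S p C)" using linear p by blast
  next
    fix B C :: "('i, 'a) rel_structure" and f q
    assume "f \<in> emb L B C" "q \<in> pair_order L S p B"
    moreover have "p A \<in> carrier A" if "A \<in> S" for A using p(1) that by (auto simp: P_def)
    ultimately show "case q of (x, y) \<Rightarrow> (f x, f y) \<in> pair_order L S p C"
      by (cases q) (simp add: pair_order_emb)
  qed
qed

section \<open>Homogeneous finite structures\<close>

text \<open>Infinite Ramsey theorem for \<open>n\<close>-element subsets, coloured by the
  isomorphism type of the induced substructure; there are finitely many types as the age is
  oligomorphic.\<close>

lemma oligomorphic_homogeneous_subset:
  fixes K :: "('i, 'a) rel_structure set"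
  assumes oligo: "oligomorphic L K" and M: "\<And>Z. Z \<subseteq> X \<Longrightarrow> finite Z \<Longrightarrow> induced L M Z \<in> K"
    and X: "infinite X"
  shows "\<exists>Y\<subseteq>X. infinite Y \<and> (\<forall>Z Z'. Z \<subseteq> Y \<longrightarrow> Z' \<subseteq> Y \<longrightarrow> finite Z \<longrightarrow> finite Z' \<longrightarrow>
    card Z = n \<longrightarrow> card Z' = n \<longrightarrow> isomorphic L (induced L M Z) (induced L M Z'))"
proof (cases "n = 0")
  \<comment> \<open>\<open>oligomorphic\<close> speaks only of positive sizes; for size 0 only the
    empty subset occurs.\<close>
  case True
  have "isomorphic L (induced L M {}) (induced L M {})"
    unfolding isomorphic_def using emb_ident[of "induced L M {}" L]
    by (intro bexI) (auto simp: induced_def)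
  then show ?thesis using X True by auto
next
  case False
  then obtain S :: "('i, 'a) rel_structure set" where S: "finite S"
    "\<And>A. A \<in> K \<Longrightarrow> card (carrier A) = n \<Longrightarrow> \<exists>B\<in>S. isomorphic L A B"
  proof -
    have "n \<ge> 1" using False by simp
    then show thesis using oligo that unfolding oligomorphic_def by meson
  qed
  have "\<exists>B\<in>S. isomorphic L (induced L M Z) B" if "Z \<subseteq> X" "finite Z" "card Z = n" for Z
    using S(2)[OF M[OF that(1,2)]] that(3) by (simp add: induced_def)
  then obtain t where t: "\<And>Z. Z \<subseteq> X \<Longrightarrow> finite Z \<Longrightarrow> card Z = n \<Longrightarrow>
      t Z \<in> S \<and> isomorphic L (induced L M Z) (t Z)"
    by metis
  \<comment> \<open>Turns the representatives into numbers below \<open>card S\<close>, the form of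
    colours in \<open>Ramsey\<close>.\<close>
  obtain idx :: "_ \<Rightarrow> nat" where idx: "inj_on idx S" "idx ` S = {i. i < card S}"
    using finite_imp_inj_to_nat_seg[OF S(1)] by (metis card_Collect_less_nat card_image)
  have "\<forall>Z. Z \<subseteq> X \<and> finite Z \<and> card Z = n \<longrightarrow> idx (t Z) < card S"
    using t idx(2) by blast
  from Ramsey[OF X this] obtain Y c where Y: "Y \<subseteq> X" "infinite Y"
    and c: "\<forall>Z. Z \<subseteq> Y \<and> finite Z \<and> card Z = n \<longrightarrow> idx (t Z) = c"
    by blast
  have "isomorphic L (induced L M Z) (induced L M Z')"
    if "Z \<subseteq> Y" "Z' \<subseteq> Y" "finite Z" "finite Z'" "card Z = n" "card Z' = n" for Z Z'
  proof -
    have "idx (t Z) = idx (t Z')" using c that by metis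
    then have "t Z = t Z'" using t[of Z] t[of Z'] that Y(1) idx(1) by (meson inj_onD subset_trans)
    then show ?thesis
      using t[of Z] t[of Z'] that Y(1) isomorphic_sym isomorphic_trans by (metis subset_trans)
  qed
  then show ?thesis using Y by blast
qed

text \<open>Infinite sets \<open>Y 0\<close>, \<open>Y 1\<close>, ... are chosen decreasing, with
  \<open>Y n\<close> homogeneous for subsets of size \<open>n\<close>, and \<open>F n\<close> is
  induced on \<open>n\<close> points of \<open>Y n\<close>. The points lie in all earlier sets too,
  which controls the smaller subsets.\<close>

lemma oligomorphic_age_homogeneous_sequence:
  fixes K :: "('i, 'a::infinite) rel_structure set"
  assumes age: "age L K" and oligo: "oligomorphic L K"
  shows "\<exists>F. (\<forall>n. F n \<in> K \<and> card (carrier (F n)) = n) \<and>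
    (\<forall>n. \<forall>Z\<subseteq>carrier (F n). \<exists>v\<in>emb L (F (card Z)) (F n). v ` carrier (F (card Z)) = Z)"
proof -
  obtain M :: "('i, 'a) rel_structure" where inf: "infinite (carrier M)"
    and M: "\<And>A. A \<in> K \<longleftrightarrow> is_structure L A \<and> finite (carrier A) \<and> emb L A M \<noteq> {}"
    using age_alt[OF age] by blast
  have ind: "induced L M Z \<in> K" if "Z \<subseteq> carrier M" "finite Z" for Z
    using that M[of "induced L M Z"] is_structure_induced[of L M Z] emb_inclusion[OF that(1), of L]
    by (auto simp: induced_def)
  define homog where "homog n Y \<longleftrightarrow> Y \<subseteq> carrier M \<and> infinite Y \<and>
    (\<forall>Z Z'. Z \<subseteq> Y \<longrightarrow> Z' \<subseteq> Y \<longrightarrow> finite Z \<longrightarrow> finite Z' \<longrightarrow>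
    card Z = n \<longrightarrow> card Z' = n \<longrightarrow> isomorphic L (induced L M Z) (induced L M Z'))" for n Y
  have homogD: "isomorphic L (induced L M Z) (induced L M Z')"
    if "homog n Y" "Z \<subseteq> Y" "Z' \<subseteq> Y" "finite Z" "finite Z'" "card Z = n" "card Z' = n" for n Y Z Z'
    using that unfolding homog_def by simp
  have step: "\<exists>Y\<subseteq>X. homog n Y" if "X \<subseteq> carrier M" "infinite X" for X n
    using oligomorphic_homogeneous_subset[OF oligo _ that(2), of M n] ind that
    unfolding homog_def by (meson subset_trans)
  have "\<exists>Y. \<forall>n. homog n (Y n) \<and> Y (Suc n) \<subseteq> Y n"
  proof (rule dependent_nat_choice)
    show "\<exists>Y. homog 0 Y" using step[OF subset_refl inf] by blast
    show "\<exists>Y'. homog (Suc n) Y' \<and> Y' \<subseteq> Y" if "homog n Y" for Y n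
      using step[of Y "Suc n"] that by (auto simp: homog_def)
  qed
  then obtain Y where Y: "\<And>n. homog n (Y n)" "\<And>n. Y (Suc n) \<subseteq> Y n" by blast
  have anti: "Y n \<subseteq> Y m" if "m \<le> n" for m n
    using lift_Suc_antimono_le[of Y, OF Y(2) that] .
  have "\<exists>Z\<subseteq>Y n. finite Z \<and> card Z = n" for n
    using Y(1)[of n] infinite_arbitrarily_large unfolding homog_def by metis
  then obtain Z where Z: "\<And>n. Z n \<subseteq> Y n" "\<And>n. finite (Z n)" "\<And>n. card (Z n) = n" by metis
  let ?F = "\<lambda>n. induced L M (Z n)"
  have car: "carrier (induced L M W) = W" for W by (simp add: induced_def)
  have "\<exists>v\<in>emb L (?F (card W)) (?F n). v ` Z (card W) = W" if W: "W \<subseteq> Z n" for n W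
  proof -
    have fin: "finite W" "card W \<le> n"
      using finite_subset[OF W Z(2)] card_mono[OF Z(2) W] Z(3)[of n] by auto
    \<comment> \<open>Since \<open>card W\<close> is at most \<open>n\<close>, both \<open>W\<close>
      and \<open>Z (card W)\<close> are subsets of \<open>Y (card W)\<close> of the size for which
      it is homogeneous.\<close>
    have "W \<subseteq> Y (card W)" using W Z(1) anti[OF fin(2)] by blast
    then have "isomorphic L (?F (card W)) (induced L M W)"
      using homogD[OF Y(1) Z(1) _ Z(2) fin(1) Z(3) refl] by simp
    then obtain f where f: "f \<in> emb L (?F (card W)) (induced L M W)" "f ` Z (card W) = W"
      by (auto simp: isomorphic_def car)
    let ?v = "compose (Z (card W)) (\<lambda>x\<in>W. x) f"
    have "?v \<in> emb L (?F (card W)) (?F n)"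
      using emb_compose[OF f(1) emb_induced_subset[OF W]] by (simp add: car)
    moreover have "?v ` Z (card W) = W" using f(2) by (force simp: compose_def)
    ultimately show ?thesis by blast
  qed
  moreover have "?F n \<in> K" for n using ind Z Y(1) unfolding homog_def by (metis subset_trans)
  ultimately show ?thesis using Z(3) by (intro exI[of _ ?F]) (auto simp: car)
qed

section \<open>The pre-adjunction\<close>

lemma finite_inj_to_infinite_type:
  assumes "finite X"
  shows "\<exists>j :: 'a \<Rightarrow> 'c::infinite. inj_on j X"
proof -
  obtain Y :: "'c set" where "finite Y" "card Y = card X"
    using infinite_arbitrarily_large[OF infinite_UNIV] by metis
  then show ?thesis using finite_same_card_bij[OF assms] by (metis bij_betw_def)
qed

theorem theorem4p7:
  fixes L :: "'i language" and K :: "('i, 'a::infinite) rel_structure set"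
  assumes "relational_language L"
    and "ramsey_age L K"
    and "oligomorphic L K"
  shows "(Ram :: ('c::infinite set \<times> 'c rel, 'c \<Rightarrow> 'c) cat) \<le>\<^sub>T struct_cat L K"
proof -
  have age: "age L K" and ramsey: "ramsey_property L K"
    using assms by (auto simp: ramsey_age_def)
  obtain ord where ord: "\<And>C. C \<in> K \<Longrightarrow> linear_order_on (carrier C) (ord C)"
    and ord_emb: "\<And>B C f x y. f \<in> emb L B C \<Longrightarrow> (x, y) \<in> ord B \<Longrightarrow> (f x, f y) \<in> ord C"
    using oligomorphic_ramsey_age_order[OF age ramsey assms(3)] by fast
  obtain G where G: "\<And>n. G n \<in> K" "\<And>n. card (carrier (G n)) = n"
    and sub: "\<And>n Z. Z \<subseteq> carrier (G n) \<Longrightarrow>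
      \<exists>v\<in>emb L (G (card Z)) (G n). v ` carrier (G (card Z)) = Z"
    using oligomorphic_age_homogeneous_sequence[OF age assms(3)] by blast
  have "\<forall>C. \<exists>j::'a \<Rightarrow> 'c. C \<in> K \<longrightarrow> inj_on j (carrier C)"
    using finite_inj_to_infinite_type age_finite[OF age] by blast
  \<comment> \<open>Structures have points in \<open>'a\<close> and chains have points in
    \<open>'c\<close>, so each carrier is copied injectively.\<close>
  then obtain j :: "_ \<Rightarrow> 'a \<Rightarrow> 'c" where j: "\<And>C. C \<in> K \<Longrightarrow> inj_on (j C) (carrier C)" by metis
  define F :: "'c set \<times> 'c rel \<Rightarrow> _" where "F = (\<lambda>(X, r). G (card X))"
  have "\<exists>e. bij_betw e X (carrier (G (card X))) \<and>
      (\<forall>(x, y)\<in>r. (e x, e y) \<in> ord (G (card X)))"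
    if "finite X" "linear_order_on X r" for X :: "'c set" and r
    using finite_chains_isomorphic[OF that age_finite[OF age] ord] G by simp
  \<comment> \<open>\<open>e X r\<close> is the order isomorphism from the chain to the canonical
    order of the structure of its size.\<close>
  then obtain e where e: "\<And>(X :: 'c set) r. finite X \<Longrightarrow> linear_order_on X r \<Longrightarrow>
      bij_betw (e X r) X (carrier (G (card X)))"
    and e_mono: "\<And>(X :: 'c set) r x y. finite X \<Longrightarrow> linear_order_on X r \<Longrightarrow> (x, y) \<in> r \<Longrightarrow>
      (e X r x, e X r y) \<in> ord (G (card X))"
    by (metis (no_types, lifting) case_prodD)
  define H where "H C = (j C ` carrier C, (\<lambda>(x, y). (j C x, j C y)) ` ord C)" for C
  \<comment> \<open>An embedding \<open>u\<close> is read on chains: enter by \<open>e X r\<close>,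
    leave by the copying map \<open>j C\<close>.\<close>
  define \<Phi> where "\<Phi> = (\<lambda>(X, r) C u. \<lambda>x\<in>X. j C (u (e X r x)))"
  interpret R: category "Ram :: ('c set \<times> 'c rel, 'c \<Rightarrow> 'c) cat" by (rule category_Ram)
  interpret S: category "struct_cat L K" by (rule category_struct_cat)
  have "pre_adjunction Ram (struct_cat L K) F H \<Phi>"
  proof
    show "F \<in> obj Ram \<rightarrow> obj (struct_cat L K)"
      using G by (auto simp: F_def struct_cat_def)
    show "H \<in> obj (struct_cat L K) \<rightarrow> obj Ram"
      using linear_order_on_image[OF ord j] age_finite[OF age]
      by (auto simp: H_def struct_cat_def Ram_def)
  next
    fix P C assume "P \<in> obj (Ram :: ('c set \<times> 'c rel, 'c \<Rightarrow> 'c) cat)"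
      and C: "C \<in> obj (struct_cat L K)"
    then obtain X r where P: "P = (X, r)" and X: "finite X" "linear_order_on X r"
      by (auto simp: Ram_def)
    show "\<Phi> P C \<in> hom (struct_cat L K) (F P) C \<rightarrow> hom Ram P (H C)"
    proof
      fix u assume "u \<in> hom (struct_cat L K) (F P) C"
      then have u: "u \<in> emb L (G (card X)) C" by (simp add: struct_cat_def F_def P)
      have C: "C \<in> K" using C by (simp add: struct_cat_def)
      have in_r: "x \<in> X" "y \<in> X" if "(x, y) \<in> r" for x y
        using that linear_orderD(1)[OF X(2)] by auto
      have ue: "u (e X r x) \<in> carrier C" if "x \<in> X" for x
        using that u bij_betwE[OF e[OF X]] by (auto simp: emb_def)
      have "inj_on (\<lambda>x. j C (u (e X r x))) X"
      proof (rule inj_onI)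
        fix x y assume xy: "x \<in> X" "y \<in> X" and "j C (u (e X r x)) = j C (u (e X r y))"
        then have "u (e X r x) = u (e X r y)" using j[OF C] ue by (auto dest: inj_onD)
        then have "e X r x = e X r y"
          using u xy bij_betwE[OF e[OF X]] by (auto simp: emb_def dest: inj_onD)
        then show "x = y" using xy e[OF X] by (auto simp: bij_betw_def dest: inj_onD)
      qed
      moreover have "(j C (u (e X r x)), j C (u (e X r y))) \<in> (\<lambda>(x, y). (j C x, j C y)) ` ord C"
        if "(x, y) \<in> r" for x y
        using ord_emb[OF u e_mono[OF X that]] by (intro image_eqI) auto
      ultimately show "\<Phi> P C u \<in> hom Ram P (H C)"
        using ue in_r by (auto simp: \<Phi>_def P Ram_def H_def)
    qed
  next
    fix C P Q u f
    assume "C \<in> obj (struct_cat L K)" and "P \<in> obj (Ram :: ('c set \<times> 'c rel, 'c \<Rightarrow> 'c) cat)"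
      and "Q \<in> obj (Ram :: ('c set \<times> 'c rel, 'c \<Rightarrow> 'c) cat)"
      and "u \<in> hom (struct_cat L K) (F Q) C" and f0: "f \<in> hom Ram P Q"
    then obtain X r Y s where P: "P = (X, r)" and X: "finite X" "linear_order_on X r"
      and Q: "Q = (Y, s)" and Y: "finite Y" "linear_order_on Y s"
      by (auto simp: Ram_def)
    have f: "f ` X \<subseteq> Y" "inj_on f X" "\<And>x y. (x, y) \<in> r \<Longrightarrow> (f x, f y) \<in> s"
      using f0 by (auto simp: Ram_def P Q)
    let ?ef = "\<lambda>x. e Y s (f x)" and ?n = "card Y"
    \<comment> \<open>The copy of the subchain \<open>f X\<close> inside \<open>G (card Y)\<close>;
      homogeneity gives an embedding \<open>v\<close> of \<open>G (card X)\<close> with exactly this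
      image.\<close>
    define Z where "Z = ?ef ` X"
    have ef: "inj_on ?ef X"
      using comp_inj_on[OF f(2) inj_on_subset[OF bij_betw_imp_inj_on[OF e[OF Y]] f(1)]]
      by (simp add: comp_def)
    have Z: "Z \<subseteq> carrier (G ?n)" using f(1) bij_betwE[OF e[OF Y]] by (auto simp: Z_def)
    have card: "card Z = card X" using ef by (simp add: Z_def card_image)
    obtain v where v: "v \<in> emb L (G (card X)) (G ?n)" "v ` carrier (G (card X)) = Z"
      using sub[OF Z] card by auto
    \<comment> \<open>Both sides are monotone injections of the chain \<open>X\<close> onto
      \<open>Z\<close>, hence equal: \<open>v\<close> preserves the canonical order like every
      embedding. Applying \<open>u\<close> and then \<open>j C\<close> to both sides yields
      (PA).\<close>
    have "?ef x = v (e X r x)" if x: "x \<in> X" for x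
    proof (rule monotone_injections_unique[OF X(2), where Y = Z and s = "ord (G ?n) \<inter> Z \<times> Z"])
      show "finite Z" using X by (simp add: Z_def)
      show "linear_order_on Z (ord (G ?n) \<inter> Z \<times> Z)"
        using linear_order_on_restrict[OF ord[OF G(1)] Z] .
      show "inj_on ?ef X" "?ef ` X = Z" by (auto simp: ef Z_def)
      show ve: "(\<lambda>x. v (e X r x)) ` X = Z"
        using v(2) bij_betw_imp_surj_on[OF e[OF X]] by (metis image_image)
      show "inj_on (\<lambda>x. v (e X r x)) X"
        using comp_inj_on[of "e X r" X v] v(1) bij_betw_imp_inj_on[OF e[OF X]]
          bij_betw_imp_surj_on[OF e[OF X]] by (simp add: emb_def comp_def)
      fix x y assume xy: "(x, y) \<in> r"
      then have "x \<in> X" "y \<in> X" using linear_orderD(1)[OF X(2)] by auto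
      then show "(?ef x, ?ef y) \<in> ord (G ?n) \<inter> Z \<times> Z"
        and "(v (e X r x), v (e X r y)) \<in> ord (G ?n) \<inter> Z \<times> Z"
        using e_mono[OF Y f(3)[OF xy]] ord_emb[OF v(1) e_mono[OF X xy]] ve
        by (auto simp: Z_def)
    qed (rule x)
    then have "composite Ram P Q (H C) (\<Phi> Q C u) f =
        \<Phi> P C (composite (struct_cat L K) (F P) (F Q) C u v)"
      using f(1) bij_betwE[OF e[OF X]]
      by (auto simp: Ram_def struct_cat_def P Q F_def \<Phi>_def H_def compose_def fun_eq_iff)
    then show "\<exists>v\<in>hom (struct_cat L K) (F P) (F Q). composite Ram P Q (H C) (\<Phi> Q C u) f =
        \<Phi> P C (composite (struct_cat L K) (F P) (F Q) C u v)"
      using v(1) by (auto simp: struct_cat_def F_def P Q)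
  qed
  then show ?thesis unfolding le_T_def by blast
qed

end
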